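(* Let $p,q\in\mathbb{N}$ (positive integers), $p-1<\alpha<p$, and consider the time fractional PDE $$D_t^\alpha u-D_x^q K([u]_x)=0,\qquad u=u(x,t),\quad (x,t)\in(a,b)\times(t_0,T).$$ If $\rho(t)$ and $\bar G=\bar G(x,t,[u]_\alpha)$ are two functions such that $$\rho(t)\,D_t^\alpha u=D_t\big(\bar G(x,t,[u]_\alpha)\big)$$ (as an identity in $u$), then the quantities $$x^k\rho(t)\big(D_t^\alpha u-D_x^qK([u]_x)\big),\qquad k=0,\ldots,q-1,$$ are conservation laws of the PDE.
   Context: The symbol $[u]_x$ denotes $u$ and its integer-order derivatives in space; $[u]_\alpha$ denotes $u$, its fractional and integer derivatives and its fractional integrals. $D_x,D_t$ are total derivatives. $D_t^\alpha$ denotes either the Riemann-Liouville derivative ${}^{\mathrm{RL}}D_t^\alpha f=D_t^p(I_t^{p-\alpha}f)$ or the Caputo derivative ${}^{\mathrm{C}}D_t^\alpha f=I_t^{p-\alpha}(D_t^pf)$, where $$I_t^{p-\alpha}f=\frac1{\Gamma(p-\alpha)}\int_{t_0}^t\frac{f(x,\tau)}{(t-\tau)^{1-p+\alpha}}\,d\tau .$$ A conservation law of the PDE is a total divergence, i.e. an expression that can be written (identically in $u$) as $$D_x\big(F(x,t,[u]_\alpha)\big)+D_t\big(G(x,t,[u]_\alpha)\big)$$ for some functions $F$ (flux) and $G$ (density), that vanishes on solutions of the PDE. It is assumed that $G$ depends on fractional integrals of order $p-\alpha$ only (not of higher order); the given $\bar G$ is understood to be of this type. All functions are understood to be regular enough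 for the expressions to make sense. *)

theory Defs
  imports "HOL-Analysis.Analysis"
begin

text \<open>
  Functions \<open>u = u(x,t)\<close> are curried, \<open>u :: real \<Rightarrow> real \<Rightarrow> real\<close>, and are considered on
  \<open>(a,b) \<times> (t0,T)\<close>. No value of \<open>u\<close> outside this open rectangle is ever used.
\<close>

definition frac_int :: "real \<Rightarrow> real \<Rightarrow> (real \<Rightarrow> real) \<Rightarrow> real \<Rightarrow> real" where
  "frac_int t0 \<beta> f t =
     1 / Gamma \<beta> * (LINT \<tau>:{t0<..<t}|lborel. f \<tau> / (t - \<tau>) powr (1 - \<beta>))"

datatype frac_kind = Riemann_Liouville | Caputo

text \<open>The derivative of order \<open>\<alpha>\<close> in \<open>t\<close>, for \<open>p - 1 < \<alpha> < p\<close>.\<close>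

definition frac_deriv ::
    "frac_kind \<Rightarrow> nat \<Rightarrow> real \<Rightarrow> real \<Rightarrow> (real \<Rightarrow> real \<Rightarrow> real) \<Rightarrow> real \<Rightarrow> real \<Rightarrow> real" where
  "frac_deriv kind p \<alpha> t0 u x t =
     (case kind of
        Riemann_Liouville \<Rightarrow> (deriv ^^ p) (frac_int t0 (real p - \<alpha>) (u x)) t
      | Caputo \<Rightarrow> frac_int t0 (real p - \<alpha>) ((deriv ^^ p) (u x)) t)"

text \<open>
  The arguments \<open>[u]\<^sub>\<alpha>\<close> of a differential function:
  \<open>Int_Deriv m j\<close> stands for \<open>D\<^sub>x\<^sup>m D\<^sub>t\<^sup>j u\<close>, and \<open>Frac m n \<beta> j\<close> for
  \<open>D\<^sub>x\<^sup>m D\<^sub>t\<^sup>n I\<^sub>t\<^sup>\<beta> D\<^sub>t\<^sup>j u\<close>. The latter covers the fractional integrals (\<open>n = j = 0\<close>), the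
  Riemann-Liouville derivatives (\<open>j = 0\<close>), the Caputo derivatives (\<open>n = 0\<close>), and the integer
  derivatives of all of these.
\<close>

datatype jet = Int_Deriv nat nat | Frac nat nat real nat

fun jet_val :: "real \<Rightarrow> (real \<Rightarrow> real \<Rightarrow> real) \<Rightarrow> real \<Rightarrow> real \<Rightarrow> jet \<Rightarrow> real" where
  "jet_val t0 u x t (Int_Deriv m j) = (deriv ^^ m) (\<lambda>y. (deriv ^^ j) (u y) t) x"
| "jet_val t0 u x t (Frac m n \<beta> j) =
     (deriv ^^ m) (\<lambda>y. (deriv ^^ n) (frac_int t0 \<beta> ((deriv ^^ j) (u y))) t) x"

definition times_differentiable :: "nat \<Rightarrow> (real \<Rightarrow> real) \<Rightarrow> real set \<Rightarrow> bool" where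
  "times_differentiable n f S \<longleftrightarrow>
     (\<forall>i<n. \<forall>s\<in>S. (deriv ^^ i) f differentiable at s)"

text \<open>
  \<open>deriv\<close> and the integral are total, so it has to be said separately that an entry of
  \<open>[u]\<^sub>\<alpha>\<close> makes sense for a given \<open>u\<close>.
\<close>

fun jet_defined ::
    "real \<Rightarrow> real \<Rightarrow> real \<Rightarrow> real \<Rightarrow> (real \<Rightarrow> real \<Rightarrow> real) \<Rightarrow> jet \<Rightarrow> bool" where
  "jet_defined a b t0 T u (Int_Deriv m j) \<longleftrightarrow>
     (\<forall>x\<in>{a<..<b}. times_differentiable j (u x) {t0<..<T}) \<and>
     (\<forall>t\<in>{t0<..<T}. times_differentiable m (\<lambda>y. (deriv ^^ j) (u y) t) {a<..<b})"
| "jet_defined a b t0 T u (Frac m n \<beta> j) \<longleftrightarrow>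
     0 < \<beta> \<and>
     (\<forall>x\<in>{a<..<b}. times_differentiable j (u x) {t0<..<T}) \<and>
     (\<forall>x\<in>{a<..<b}. \<forall>t\<in>{t0<..<T}.
        set_integrable lborel {t0<..<t} (\<lambda>\<tau>. (deriv ^^ j) (u x) \<tau> / (t - \<tau>) powr (1 - \<beta>))) \<and>
     (\<forall>x\<in>{a<..<b}. times_differentiable n (frac_int t0 \<beta> ((deriv ^^ j) (u x))) {t0<..<T}) \<and>
     (\<forall>t\<in>{t0<..<T}.
        times_differentiable m
          (\<lambda>y. (deriv ^^ n) (frac_int t0 \<beta> ((deriv ^^ j) (u y))) t) {a<..<b})"

fun frac_deriv_jet :: "frac_kind \<Rightarrow> nat \<Rightarrow> real \<Rightarrow> jet" where
  "frac_deriv_jet Riemann_Liouville p \<alpha> = Frac 0 p (real p - \<alpha>) 0"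
| "frac_deriv_jet Caputo p \<alpha> = Frac 0 0 (real p - \<alpha>) p"

lemma jet_val_frac_deriv_jet:
  "jet_val t0 u x t (frac_deriv_jet kind p \<alpha>) = frac_deriv kind p \<alpha> t0 u x t"
  by (cases kind) (simp_all add: frac_deriv_def)

definition depends_only_on :: "'c set \<Rightarrow> (('c \<Rightarrow> real) \<Rightarrow> 'b) \<Rightarrow> bool" where
  "depends_only_on S f \<longleftrightarrow> (\<forall>z z'. (\<forall>c\<in>S. z c = z' c) \<longrightarrow> f z = f z')"

text \<open>
  A function \<open>H(x,t,[u]\<^sub>\<alpha>)\<close>: it has finitely many arguments from \<open>[u]\<^sub>\<alpha>\<close>, all of them in \<open>J\<close>
  and all of them meaningful for each \<open>u\<close> in the class \<open>U\<close> of functions under consideration.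
\<close>

type_synonym dfun = "real \<Rightarrow> real \<Rightarrow> (jet \<Rightarrow> real) \<Rightarrow> real"

definition differential_function ::
    "real \<Rightarrow> real \<Rightarrow> real \<Rightarrow> real \<Rightarrow> (real \<Rightarrow> real \<Rightarrow> real) set \<Rightarrow> jet set \<Rightarrow> dfun \<Rightarrow> bool" where
  "differential_function a b t0 T U J H \<longleftrightarrow>
     (\<exists>S. finite S \<and> S \<subseteq> J \<and> (\<forall>u\<in>U. \<forall>c\<in>S. jet_defined a b t0 T u c) \<and>
        (\<forall>x t. depends_only_on S (H x t)))"

definition on_jet :: "real \<Rightarrow> dfun \<Rightarrow> (real \<Rightarrow> real \<Rightarrow> real) \<Rightarrow> real \<Rightarrow> real \<Rightarrow> real" where
  "on_jet t0 H u x t = H x t (jet_val t0 u x t)"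

text \<open>The arguments allowed in a density: no fractional integral of order other than \<open>p - \<alpha>\<close>.\<close>

definition density_jets :: "nat \<Rightarrow> real \<Rightarrow> jet set" where
  "density_jets p \<alpha> = {Int_Deriv m j |m j. True} \<union> {Frac m n (real p - \<alpha>) j |m n j. True}"

text \<open>
  Identities in \<open>u\<close> are meant for all \<open>u\<close> in a class \<open>U\<close> of sufficiently regular functions. Total
  derivatives are the \<open>x\<close>- and \<open>t\<close>-derivatives of the composite with \<open>[u]\<^sub>\<alpha>\<close>.
\<close>

definition total_divergence ::
    "real \<Rightarrow> real \<Rightarrow> real \<Rightarrow> real \<Rightarrow> nat \<Rightarrow> real \<Rightarrow> (real \<Rightarrow> real \<Rightarrow> real) set \<Rightarrow>
     ((real \<Rightarrow> real \<Rightarrow> real) \<Rightarrow> real \<Rightarrow> real \<Rightarrow> real) \<Rightarrow> bool" where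
  "total_divergence a b t0 T p \<alpha> U E \<longleftrightarrow>
     (\<exists>F G. differential_function a b t0 T U UNIV F \<and>
        differential_function a b t0 T U (density_jets p \<alpha>) G \<and>
        (\<forall>u\<in>U. \<forall>x\<in>{a<..<b}. \<forall>t\<in>{t0<..<T}.
           (\<lambda>y. on_jet t0 F u y t) differentiable at x \<and>
           (\<lambda>s. on_jet t0 G u x s) differentiable at t \<and>
           E u x t = deriv (\<lambda>y. on_jet t0 F u y t) x + deriv (\<lambda>s. on_jet t0 G u x s) t))"

definition conservation_law ::
    "real \<Rightarrow> real \<Rightarrow> real \<Rightarrow> real \<Rightarrow> nat \<Rightarrow> real \<Rightarrow> (real \<Rightarrow> real \<Rightarrow> real) set \<Rightarrow>
     ((real \<Rightarrow> real \<Rightarrow> real) \<Rightarrow> real \<Rightarrow> real \<Rightarrow> real) \<Rightarrow>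
     ((real \<Rightarrow> real \<Rightarrow> real) \<Rightarrow> real \<Rightarrow> real \<Rightarrow> real) \<Rightarrow> bool" where
  "conservation_law a b t0 T p \<alpha> U \<Delta> E \<longleftrightarrow>
     total_divergence a b t0 T p \<alpha> U E \<and>
     (\<forall>u\<in>U. (\<forall>x\<in>{a<..<b}. \<forall>t\<in>{t0<..<T}. \<Delta> u x t = 0) \<longrightarrow>
             (\<forall>x\<in>{a<..<b}. \<forall>t\<in>{t0<..<T}. E u x t = 0))"

text \<open>\<open>[u]\<^sub>x\<close> is the sequence \<open>u, u\<^sub>x, u\<^sub>x\<^sub>x, \<dots>\<close>; \<open>K\<close> will only look at finitely many entries.\<close>

definition xjet :: "(real \<Rightarrow> real \<Rightarrow> real) \<Rightarrow> real \<Rightarrow> real \<Rightarrow> nat \<Rightarrow> real" where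
  "xjet u x t i = (deriv ^^ i) (\<lambda>y. u y t) x"

definition pde ::
    "frac_kind \<Rightarrow> nat \<Rightarrow> real \<Rightarrow> real \<Rightarrow> nat \<Rightarrow> ((nat \<Rightarrow> real) \<Rightarrow> real) \<Rightarrow>
     (real \<Rightarrow> real \<Rightarrow> real) \<Rightarrow> real \<Rightarrow> real \<Rightarrow> real" where
  "pde kind p \<alpha> t0 q K u x t =
     frac_deriv kind p \<alpha> t0 u x t - (deriv ^^ q) (\<lambda>y. K (xjet u y t)) x"

text \<open>
  \<open>n\<close> times continuously differentiable on \<open>W\<close>, by partial derivatives. The type
  \<open>nat \<Rightarrow> real\<close> has the product topology, so for functions of finitely many coordinates and
  open \<open>W\<close> this is the usual notion.
\<close>

fun C_k_on :: "nat \<Rightarrow> (nat \<Rightarrow> real) set \<Rightarrow> ((nat \<Rightarrow> real) \<Rightarrow> real) \<Rightarrow> bool" where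
  "C_k_on 0 W f \<longleftrightarrow> continuous_on W f"
| "C_k_on (Suc n) W f \<longleftrightarrow>
     continuous_on W f \<and>
     (\<forall>i. (\<forall>z\<in>W. (\<lambda>s. f (z(i := s))) differentiable at (z i)) \<and>
          C_k_on n W (\<lambda>z. deriv (\<lambda>s. f (z(i := s))) (z i)))"

text \<open>
  The regularity that gives meaning to the equation
  \<open>D\<^sub>t\<^sup>\<alpha> u = D\<^sub>x\<^sup>q K(u, u\<^sub>x, \<dots>, D\<^sub>x\<^sup>m u)\<close> for a given \<open>u\<close>. The set \<open>W\<close> is the domain of \<open>K\<close>,
  so that nonlinearities such as \<open>1/u\<close> or \<open>ln u\<close> are included.
\<close>

definition regular_for ::
    "real \<Rightarrow> real \<Rightarrow> real \<Rightarrow> real \<Rightarrow> frac_kind \<Rightarrow> nat \<Rightarrow> real \<Rightarrow> nat \<Rightarrow> nat \<Rightarrow>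
     (nat \<Rightarrow> real) set \<Rightarrow> (real \<Rightarrow> real \<Rightarrow> real) \<Rightarrow> bool" where
  "regular_for a b t0 T kind p \<alpha> q m W u \<longleftrightarrow>
     jet_defined a b t0 T u (frac_deriv_jet kind p \<alpha>) \<and>
     jet_defined a b t0 T u (Int_Deriv (m + q) 0) \<and>
     (\<forall>x\<in>{a<..<b}. \<forall>t\<in>{t0<..<T}. xjet u x t \<in> W)"

end

theory Submission
  imports Defs
begin

text \<open>
  Since \<open>k < q\<close>, integrating \<open>x\<^sup>k D\<^sub>x\<^sup>q K\<close> by parts \<open>k\<close> times leaves no remainder integral, so
  \<open>x\<^sup>k D\<^sub>x\<^sup>q K\<close> is itself an \<open>x\<close>-derivative; the fractional part is the \<open>t\<close>-derivative of
  \<open>x\<^sup>k Gbar\<close>. To see that the flux is a function of finitely many jet variables, \<open>D\<^sub>x\<^sup>i K\<close> is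
  written by the chain rule as a function on jet space.
\<close>

abbreviation partial :: "nat \<Rightarrow> ((nat \<Rightarrow> real) \<Rightarrow> real) \<Rightarrow> (nat \<Rightarrow> real) \<Rightarrow> real" where
  "partial i f z \<equiv> deriv (\<lambda>s. f (z(i := s))) (z i)"

subsection \<open>Functions of class \<open>C\<^sup>k\<close> on jet space\<close>

text \<open>\<open>deriv\<close> is total and sees values outside \<open>W\<close>. Because the
  slice map is continuous for the product topology, only values in \<open>W\<close> matter near
  \<open>z i\<close>, so identities valid on \<open>W\<close> may be differentiated.\<close>

lemma eventually_slice_in_open:
  fixes W :: "(nat \<Rightarrow> real) set"
  assumes "open W" "z \<in> W"
  shows "eventually (\<lambda>s. z(i := s) \<in> W) (nhds (z i))"
proof -
  have "continuous_on UNIV (\<lambda>s. z(i := s))"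
  proof (rule continuous_on_coordinatewise_then_product)
    show "continuous_on UNIV (\<lambda>s. (z(i := s)) j)" for j
      by (cases "j = i") auto
  qed
  then have "open ((\<lambda>s. z(i := s)) -` W)"
    using assms(1) by (simp add: continuous_on_open_vimage)
  then show ?thesis
    using assms(2) eventually_nhds_in_open[of _ "z i"] by fastforce
qed

lemma C_k_on_imp_continuous_on: "C_k_on n W f \<Longrightarrow> continuous_on W f"
  by (cases n) auto

lemma C_k_on_Suc_has_derivative:
  assumes "C_k_on (Suc n) W f" "z \<in> W"
  shows "((\<lambda>s. f (z(i := s))) has_real_derivative partial i f z) (at (z i))"
  unfolding DERIV_deriv_iff_real_differentiable
  by (rule assms(1)[unfolded C_k_on.simps, THEN conjunct2, THEN spec, THEN conjunct1,
        THEN bspec, OF assms(2)])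

lemma C_k_on_partial: "C_k_on (Suc n) W f \<Longrightarrow> C_k_on n W (partial i f)"
  by (simp del: fun_upd_apply)

lemma C_k_on_SucI:
  assumes "continuous_on W f"
    and "\<And>i z. z \<in> W \<Longrightarrow> (\<lambda>s. f (z(i := s))) differentiable at (z i)"
    and "\<And>i. C_k_on n W (partial i f)"
  shows "C_k_on (Suc n) W f"
  unfolding C_k_on.simps by (intro conjI allI ballI assms)

lemma partial_cong:
  assumes "open W" "z \<in> W" "\<And>z. z \<in> W \<Longrightarrow> f z = g z"
  shows "partial i f z = partial i g z"
  using eventually_slice_in_open[OF assms(1,2), of i] assms(3)
  by (intro deriv_cong_ev) (auto elim!: eventually_mono simp del: fun_upd_apply)

lemma C_k_on_cong:
  assumes "open W" "C_k_on n W f" "\<And>z. z \<in> W \<Longrightarrow> f z = g z"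
  shows "C_k_on n W g"
  using assms(2,3)
proof (induction n arbitrary: f g)
  case 0
  then show ?case by (simp cong: continuous_on_cong)
next
  case (Suc n)
  have D: "(\<lambda>s. g (z(i := s))) differentiable at (z i)" if "z \<in> W" for i z
  proof -
    have ev: "eventually (\<lambda>s. f (z(i := s)) = g (z(i := s))) (nhds (z i))"
      using eventually_slice_in_open[OF assms(1) that, of i]
      by (rule eventually_mono) (rule Suc.prems(2))
    from C_k_on_Suc_has_derivative[OF Suc.prems(1) that]
    have "((\<lambda>s. g (z(i := s))) has_real_derivative partial i f z) (at (z i))"
      by (rule iffD1[OF DERIV_cong_ev[OF refl ev refl]])
    then show ?thesis
      by (rule differentiableI[OF has_field_derivative_imp_has_derivative])
  qed
  have C: "C_k_on n W (partial i g)" for i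
    by (rule Suc.IH[OF C_k_on_partial[OF Suc.prems(1)]])
       (rule partial_cong[OF assms(1) _ Suc.prems(2)])
  have "continuous_on W g"
    using C_k_on_imp_continuous_on[OF Suc.prems(1)] Suc.prems(2) by (simp cong: continuous_on_cong)
  then show ?case
    by (rule C_k_on_SucI[OF _ D C])
qed

lemma C_k_on_const: "C_k_on n W (\<lambda>z. c)"
  by (induction n arbitrary: c) auto

text \<open>Allows closed formulas for the partial derivatives, known only on \<open>W\<close>, in
  place of \<open>deriv\<close>; \<open>C_k_on_cong\<close> absorbs the difference off
  \<open>W\<close>.\<close>

lemma C_k_on_Suc_if_has_derivative:
  assumes "open W" "continuous_on W f"
    and "\<And>i z. z \<in> W \<Longrightarrow> ((\<lambda>s. f (z(i := s))) has_real_derivative f' i z) (at (z i))"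
    and "\<And>i. C_k_on n W (f' i)"
  shows "C_k_on (Suc n) W f"
proof -
  have C: "C_k_on n W (partial i f)" for i
    by (rule C_k_on_cong[OF assms(1,4)]) (rule DERIV_imp_deriv[OF assms(3), symmetric])
  have D: "(\<lambda>s. f (z(i := s))) differentiable at (z i)" if "z \<in> W" for i z
    by (rule differentiableI[OF has_field_derivative_imp_has_derivative[OF assms(3)[OF that]]])
  show ?thesis
    by (rule C_k_on_SucI[OF assms(2) D C])
qed

lemma C_k_on_add:
  assumes "open W" "C_k_on n W f" "C_k_on n W g"
  shows "C_k_on n W (\<lambda>z. f z + g z)"
  using assms(2,3)
proof (induction n arbitrary: f g)
  case 0
  then show ?case by (auto intro: continuous_on_add)
next
  case (Suc n)
  show ?case
  proof (rule C_k_on_Suc_if_has_derivative[OF assms(1)])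
    show "((\<lambda>s. f (z(i := s)) + g (z(i := s))) has_real_derivative partial i f z + partial i g z)
        (at (z i))" if "z \<in> W" for i z
      using Suc.prems that by (intro DERIV_add C_k_on_Suc_has_derivative)
    show "C_k_on n W (\<lambda>z. partial i f z + partial i g z)" for i
      using Suc.prems by (intro Suc.IH C_k_on_partial)
    show "continuous_on W (\<lambda>z. f z + g z)"
      using Suc.prems by (intro continuous_on_add C_k_on_imp_continuous_on)
  qed
qed

lemma C_k_on_sum:
  assumes "open W" "\<And>i. i \<in> A \<Longrightarrow> C_k_on n W (f i)"
  shows "C_k_on n W (\<lambda>z. \<Sum>i\<in>A. f i z)"
  using assms(2)
  by (induction A rule: infinite_finite_induct)
     (auto intro: C_k_on_add[OF assms(1)] C_k_on_const)

lemma C_k_on_SucD: "C_k_on (Suc n) W f \<Longrightarrow> C_k_on n W f"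
  by (induction n arbitrary: f) auto

text \<open>Each term of a total derivative is a partial derivative times a coordinate. The product
  rule returns a product of the same shape, plus \<open>f\<close> itself when \<open>i = j\<close>,
  so the induction closes.\<close>

lemma C_k_on_mult_coordinate:
  assumes "open W" "C_k_on n W f"
  shows "C_k_on n W (\<lambda>z. f z * z j)"
  using assms(2)
proof (induction n arbitrary: f)
  case 0
  then show ?case
    by (auto intro!: continuous_on_mult continuous_on_subset[OF continuous_on_product_coordinates])
next
  case (Suc n)
  show ?case
  proof (rule C_k_on_Suc_if_has_derivative[OF assms(1)])
    show "((\<lambda>s. f (z(i := s)) * (z(i := s)) j) has_real_derivative
        partial i f z * z j + (if i = j then f z else 0)) (at (z i))" if "z \<in> W" for i z
    proof -
      have "((\<lambda>s. (z(i := s)) j) has_real_derivative (if i = j then 1 else 0)) (at (z i))"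
        by auto
      from DERIV_mult[OF C_k_on_Suc_has_derivative[OF Suc.prems that] this]
      show ?thesis
        by (rule DERIV_cong) (simp del: fun_upd_apply)
    qed
    show "C_k_on n W (\<lambda>z. partial i f z * z j + (if i = j then f z else 0))" for i
    proof (rule C_k_on_add[OF assms(1)])
      show "C_k_on n W (\<lambda>z. partial i f z * z j)"
        using Suc.prems by (intro Suc.IH C_k_on_partial)
      show "C_k_on n W (\<lambda>z. if i = j then f z else 0)"
        using C_k_on_SucD[OF Suc.prems] C_k_on_const by (cases "i = j") auto
    qed
    show "continuous_on W (\<lambda>z. f z * z j)"
      using C_k_on_imp_continuous_on[OF Suc.prems]
      by (auto intro!: continuous_on_mult continuous_on_subset[OF continuous_on_product_coordinates])
  qed
qed

lemma depends_only_onD: "depends_only_on S f \<Longrightarrow> (\<And>c. c \<in> S \<Longrightarrow> z c = z' c) \<Longrightarrow> f z = f z'"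
  unfolding depends_only_on_def by blast

subsection \<open>The chain rule along a curve in jet space\<close>

lemma isCont_product:
  fixes h :: "'a::t2_space \<Rightarrow> nat \<Rightarrow> real"
  assumes "\<And>i. isCont (\<lambda>y. h y i) x"
  shows "isCont h x"
proof -
  have "limitin (product_topology (\<lambda>i. euclidean) UNIV) h (h x) (at x)"
    unfolding limitin_componentwise using assms by (simp add: isCont_def)
  then show ?thesis
    by (simp add: isCont_def euclidean_product_topology)
qed

text \<open>
  The coordinates are released one after another; each step is the two-variable chain rule for
  the coordinates released so far and the next one.
\<close>

lemma chain_rule_first_coordinates:
  fixes g :: "real \<Rightarrow> nat \<Rightarrow> real"
  assumes "open W" "C_k_on (Suc k) W f" "g x \<in> W"
    and "\<And>i. i < n \<Longrightarrow> ((\<lambda>y. g y i) has_real_derivative g' i) (at x)"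
  shows "((\<lambda>y. f (\<lambda>j. if j < n then g y j else g x j)) has_real_derivative
           (\<Sum>i<n. partial i f (g x) * g' i)) (at x)"
  using assms(4)
proof (induction n)
  case 0
  then show ?case by simp
next
  case (Suc n)
  \<comment> \<open>Coordinates below \<open>n\<close> follow the curve, coordinate \<open>n\<close>
    is a free variable \<open>r\<close>, and the rest stay frozen at \<open>g x\<close>. Putting
    \<open>r = g y n\<close> gives the curve of the next stage.\<close>
  define w where "w = (\<lambda>(y, r) j. if j < n then g y j else if j = n then r else g x j)"
  have w0: "w (x, g x n) = g x"
    by (auto simp: w_def)
  have "isCont (\<lambda>y. g y j) x" if "j < n" for j
    using Suc.prems[of j] that DERIV_isCont by simp
  then have "isCont (\<lambda>v. g (fst v) j) (x, g x n)" if "j < n" for j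
    using that isCont_o2[of "(x, g x n)" fst "\<lambda>y. g y j"] by simp
  then have "isCont (\<lambda>v. w v i) (x, g x n)" for i
    by (cases i n rule: linorder_cases) (simp_all add: w_def case_prod_unfold)
  then have cont_w: "isCont w (x, g x n)"
    by (rule isCont_product)
  then have "eventually (\<lambda>v. w v \<in> W) (nhds (x, g x n))"
    using topological_tendstoD[OF cont_w[unfolded isCont_def tendsto_at_iff_tendsto_nhds]]
      assms(1,3) w0 by simp
  then obtain X0 Y0 where XY0: "open X0" "open Y0" "x \<in> X0" "g x n \<in> Y0"
    "\<And>v. v \<in> X0 \<times> Y0 \<Longrightarrow> w v \<in> W"
    unfolding nhds_prod eventually_prod_filter eventually_nhds by (metis mem_Times_iff prod.collapse)
  \<comment> \<open>The factor for \<open>r\<close> is shrunk to a ball because the two-variable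
    criterion below needs it convex.\<close>
  obtain e where e: "e > 0" "ball (g x n) e \<subseteq> Y0"
    using XY0 openE by metis
  define Y where "Y = ball (g x n) e"
  have XY: "open X0" "open Y" "convex Y" "x \<in> X0" "g x n \<in> Y"
    "\<And>y r. y \<in> X0 \<Longrightarrow> r \<in> Y \<Longrightarrow> w (y, r) \<in> W"
    using XY0 e by (auto simp: Y_def)
  have upd: "(w (y, r))(n := s) = w (y, s)" "w (y, r) n = r" for y r s
    by (auto simp: w_def)
  \<comment> \<open>The criterion asks for the \<open>y\<close>-derivative only at the base point,
    which the induction hypothesis gives. Only the \<open>r\<close>-derivative must exist on the
    whole product and be continuous at that point; it is \<open>partial n f\<close>.\<close>
  have D: "((\<lambda>(y, r). f (w (y, r))) has_derivative
      (\<lambda>(ty, tr). (\<Sum>i<n. partial i f (g x) * g' i) * ty +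
         blinfun_mult_right (partial n f (w (x, g x n))) tr)) (at (x, g x n) within X0 \<times> Y)"
  proof (rule has_derivative_partialsI)
    have "(\<lambda>j. if j < n then g y j else g x j) = w (y, g x n)" for y
      by (auto simp: w_def)
    then have "((\<lambda>y. f (w (y, g x n))) has_real_derivative (\<Sum>i<n. partial i f (g x) * g' i)) (at x)"
      using Suc.IH[OF Suc.prems] by (simp del: fun_upd_apply)
    then show "((\<lambda>y. f (w (y, g x n))) has_derivative (*) (\<Sum>i<n. partial i f (g x) * g' i))
        (at x within X0)"
      by (simp add: has_field_derivative_def has_derivative_at_withinI)
    show "((\<lambda>r. f (w (y, r))) has_derivative blinfun_mult_right (partial n f (w (y, r))))
        (at r within Y)" if "y \<in> X0" "r \<in> Y" for y r
      using C_k_on_Suc_has_derivative[OF assms(2) XY(6)[OF that], of n]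
      by (simp add: upd has_field_derivative_def has_derivative_at_withinI)
    have "continuous_on W (partial n f)"
      by (rule C_k_on_imp_continuous_on[OF C_k_on_partial[OF assms(2)]])
    then have "isCont (partial n f) (w (x, g x n))"
      unfolding w0 continuous_on_eq_continuous_at[OF assms(1)] using assms(3) by blast
    then have "isCont (\<lambda>v. partial n f (w v)) (x, g x n)"
      by (rule isCont_o2[OF cont_w])
    then have "isCont (\<lambda>v. blinfun_mult_right (partial n f (w v))) (x, g x n)"
      by (rule bounded_linear.isCont[OF bounded_linear_blinfun_mult_right])
    then show "continuous (at (x, g x n) within X0 \<times> Y)
        (\<lambda>(y, r). blinfun_mult_right (partial n f (w (y, r))))"
      by (simp add: case_prod_unfold continuous_at_imp_continuous_at_within)
  qed (use XY in auto)
  have "(x, g x n) \<in> X0 \<times> Y" "open (X0 \<times> Y)"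
    using XY by (auto intro: open_Times)
  then have D: "((\<lambda>v. f (w v)) has_derivative
      (\<lambda>(ty, tr). (\<Sum>i<n. partial i f (g x) * g' i) * ty + partial n f (g x) * tr))
      (at (x, g x n))"
    using D at_within_open[of "(x, g x n)" "X0 \<times> Y"] by (simp add: w0 case_prod_unfold)
  \<comment> \<open>Composing with this curve releases coordinate \<open>n\<close> and adds the
    summand with index \<open>n\<close>.\<close>
  have "((\<lambda>y. (y, g y n)) has_derivative (\<lambda>h. (h, g' n * h))) (at x)"
    using Suc.prems[of n] by (auto intro!: has_derivative_Pair simp: has_field_derivative_def)
  from has_derivative_compose[OF this D]
  have D': "((\<lambda>y. f (w (y, g y n))) has_real_derivative (\<Sum>i<Suc n. partial i f (g x) * g' i)) (at x)"
    unfolding has_field_derivative_def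
    by (rule has_derivative_eq_rhs) (auto simp: algebra_simps fun_eq_iff)
  have w_Suc: "w (y, g y n) = (\<lambda>j. if j < Suc n then g y j else g x j)" for y
    by (auto simp: w_def fun_eq_iff less_Suc_eq)
  show ?case
    by (rule D'[unfolded w_Suc])
qed

text \<open>\<open>D\<^sub>x f\<close> for a function \<open>f\<close> of the jet coordinates \<open>0, \<dots>, M\<close>.\<close>

definition total_deriv :: "nat \<Rightarrow> ((nat \<Rightarrow> real) \<Rightarrow> real) \<Rightarrow> (nat \<Rightarrow> real) \<Rightarrow> real" where
  "total_deriv M f z = (\<Sum>i\<le>M. partial i f z * z (Suc i))"

text \<open>The bound grows by one because the last summand contains \<open>z (Suc M)\<close>.
  Agreement up to \<open>M\<close> already makes the slices of \<open>f\<close> equal, hence also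
  their derivatives.\<close>

lemma depends_only_on_total_deriv:
  assumes "depends_only_on {..M} f"
  shows "depends_only_on {..Suc M} (total_deriv M f)"
  unfolding depends_only_on_def
proof (intro allI impI)
  fix z z' :: "nat \<Rightarrow> real"
  assume eq: "\<forall>c\<in>{..Suc M}. z c = z' c"
  have slice: "(\<lambda>s. f (z(i := s))) = (\<lambda>s. f (z'(i := s)))" for i
    by (intro ext depends_only_onD[OF assms]) (use eq in auto)
  show "total_deriv M f z = total_deriv M f z'"
    unfolding total_deriv_def
  proof (rule sum.cong[OF refl])
    fix i assume "i \<in> {..M}"
    then have "z i = z' i" "z (Suc i) = z' (Suc i)"
      using eq by auto
    then show "partial i f z * z (Suc i) = partial i f z' * z' (Suc i)"
      by (simp only: slice)
  qed
qed

lemma C_k_on_total_deriv: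
  assumes "open W" "C_k_on (Suc n) W f"
  shows "C_k_on n W (total_deriv M f)"
  unfolding total_deriv_def
  using assms by (intro C_k_on_sum C_k_on_mult_coordinate C_k_on_partial)

text \<open>Freezing the coordinates above \<open>M\<close> does not change \<open>f\<close>, so the
  finite chain rule applies to the whole curve. The last hypothesis says that \<open>g\<close> is a
  jet: each coordinate is the derivative of the preceding one.\<close>

lemma has_derivative_along_jet:
  assumes "open W" "C_k_on (Suc n) W f" "depends_only_on {..M} f" "g x \<in> W"
    and "\<And>i. i \<le> M \<Longrightarrow> ((\<lambda>y. g y i) has_real_derivative g x (Suc i)) (at x)"
  shows "((\<lambda>y. f (g y)) has_real_derivative total_deriv M f (g x)) (at x)"
proof -
  have "f (\<lambda>j. if j < Suc M then g y j else g x j) = f (g y)" for y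
    by (rule depends_only_onD[OF assms(3)]) auto
  moreover have "((\<lambda>y. f (\<lambda>j. if j < Suc M then g y j else g x j)) has_real_derivative
      (\<Sum>i<Suc M. partial i f (g x) * g x (Suc i))) (at x)"
    by (rule chain_rule_first_coordinates[OF assms(1,2)]) (use assms(4,5) in auto)
  ultimately show ?thesis
    unfolding total_deriv_def lessThan_Suc_atMost by (simp only:)
qed

text \<open>The summation bound is \<open>m + i\<close> because each total derivative brings in one
  further coordinate.\<close>

primrec total_deriv_iter :: "nat \<Rightarrow> ((nat \<Rightarrow> real) \<Rightarrow> real) \<Rightarrow> nat \<Rightarrow> (nat \<Rightarrow> real) \<Rightarrow> real" where
  "total_deriv_iter m f 0 = f"
| "total_deriv_iter m f (Suc i) = total_deriv (m + i) (total_deriv_iter m f i)"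

lemma depends_only_on_total_deriv_iter:
  "depends_only_on {..m} f \<Longrightarrow> depends_only_on {..m + i} (total_deriv_iter m f i)"
  by (induction i) (auto intro: depends_only_on_total_deriv)

lemma C_k_on_total_deriv_iter:
  assumes "open W"
  shows "C_k_on (n + i) W f \<Longrightarrow> C_k_on n W (total_deriv_iter m f i)"
  by (induction i arbitrary: n) (auto intro: C_k_on_total_deriv[OF assms] simp del: C_k_on.simps)

lemma has_derivative_total_deriv_iter:
  assumes "open W" "C_k_on q W f" "depends_only_on {..m} f" "i < q" "g x \<in> W"
    and "\<And>r. r < m + q \<Longrightarrow> ((\<lambda>y. g y r) has_real_derivative g x (Suc r)) (at x)"
  shows "((\<lambda>y. total_deriv_iter m f i (g y)) has_real_derivative
           total_deriv_iter m f (Suc i) (g x)) (at x)"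
proof -
  \<comment> \<open>Since \<open>i < q\<close>, at least one order of smoothness is left after
    \<open>i\<close> total derivatives, as the chain rule requires.\<close>
  have "C_k_on (Suc (q - Suc i) + i) W f"
    using assms(2,4) by simp
  note C = C_k_on_total_deriv_iter[OF assms(1) this]
  show ?thesis
    unfolding total_deriv_iter.simps
    by (rule has_derivative_along_jet[where g = g,
          OF assms(1) C depends_only_on_total_deriv_iter[OF assms(3)] assms(5) assms(6)])
       (use assms(4) in simp)
qed

lemma iterated_deriv_along_jet:
  assumes "open W" "C_k_on q W f" "depends_only_on {..m} f" "i \<le> q" "open X" "x \<in> X"
    and "\<And>x. x \<in> X \<Longrightarrow> g x \<in> W"
    and "\<And>x r. x \<in> X \<Longrightarrow> r < m + q \<Longrightarrow> ((\<lambda>y. g y r) has_real_derivative g x (Suc r)) (at x)"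
  shows "(deriv ^^ i) (\<lambda>y. f (g y)) x = total_deriv_iter m f i (g x)"
  using assms(4,6)
proof (induction i arbitrary: x)
  case (Suc i)
  \<comment> \<open>Openness of \<open>X\<close> turns the pointwise induction hypothesis into an
    identity near \<open>x\<close>, which can be differentiated.\<close>
  have "eventually (\<lambda>y. (deriv ^^ i) (\<lambda>y. f (g y)) y = total_deriv_iter m f i (g y)) (nhds x)"
    using eventually_nhds_in_open[OF assms(5) Suc.prems(2)] Suc
    by (auto elim!: eventually_mono)
  then have "(deriv ^^ Suc i) (\<lambda>y. f (g y)) x = deriv (\<lambda>y. total_deriv_iter m f i (g y)) x"
    by (auto intro: deriv_cong_ev)
  also have "\<dots> = total_deriv_iter m f (Suc i) (g x)"
    using Suc.prems
    by (intro DERIV_imp_deriv has_derivative_total_deriv_iter[OF assms(1-3)] assms(7,8)) auto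
  finally show ?case .
qed simp

subsection \<open>Repeated integration by parts\<close>

text \<open>For \<open>h i = D\<^sub>x\<^sup>i K\<close> this is the antiderivative of \<open>x\<^sup>k D\<^sub>x\<^sup>n\<^sup>+\<^sup>1 K\<close>, provided \<open>k \<le> n\<close>.\<close>

primrec by_parts :: "(nat \<Rightarrow> real) \<Rightarrow> nat \<Rightarrow> nat \<Rightarrow> real \<Rightarrow> real" where
  "by_parts h 0 n x = h n"
| "by_parts h (Suc k) n x = x ^ Suc k * h n - real (Suc k) * by_parts h k (n - 1) x"

lemma by_parts_cong:
  "(\<And>i. i \<le> n \<Longrightarrow> h i = h' i) \<Longrightarrow> by_parts h k n x = by_parts h' k n x"
  by (induction k arbitrary: n) auto

text \<open>Differentiating \<open>x ^ Suc k * h n\<close> leaves, besides the wanted term,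
  \<open>Suc k\<close> times \<open>x ^ k * h n\<close>; the derivative of the recursive term
  cancels exactly this.\<close>

lemma has_derivative_by_parts:
  fixes h :: "nat \<Rightarrow> real \<Rightarrow> real"
  assumes "k \<le> n" "\<And>i. i \<le> n \<Longrightarrow> (h i has_real_derivative h (Suc i) x) (at x)"
  shows "((\<lambda>y. by_parts (\<lambda>i. h i y) k n y) has_real_derivative x ^ k * h (Suc n) x) (at x)"
  using assms
proof (induction k arbitrary: n)
  case (Suc k)
  \<comment> \<open>\<open>k \<le> n\<close> keeps the truncated \<open>n - 1\<close> a true
    predecessor throughout the recursion.\<close>
  then obtain l where n: "n = Suc l"
    by (cases n) auto
  have IH: "((\<lambda>y. by_parts (\<lambda>i. h i y) k l y) has_real_derivative x ^ k * h n x) (at x)"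
    using Suc by (simp add: n)
  have pow: "((\<lambda>y. y ^ Suc k) has_real_derivative real (Suc k) * x ^ k) (at x)"
    using DERIV_pow[of "Suc k" x UNIV] by simp
  have "((\<lambda>y. y ^ Suc k * h n y - real (Suc k) * by_parts (\<lambda>i. h i y) k l y) has_real_derivative
      (real (Suc k) * x ^ k * h n x + h (Suc n) x * x ^ Suc k) - real (Suc k) * (x ^ k * h n x)) (at x)"
    using Suc.prems by (intro DERIV_diff DERIV_mult DERIV_cmult IH pow) auto
  then show ?case
    by (simp add: n algebra_simps)
qed simp

subsection \<open>Conservation laws\<close>

lemma differential_function_scale:
  assumes "differential_function a b t0 T U J H"
  shows "differential_function a b t0 T U J (\<lambda>x t z. c x t * H x t z)"
  using assms unfolding differential_function_def depends_only_on_def by metis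

lemma jet_defined_Int_Deriv_mono:
  "jet_defined a b t0 T u (Int_Deriv n j) \<Longrightarrow> m \<le> n \<Longrightarrow> jet_defined a b t0 T u (Int_Deriv m j)"
  by (auto simp: times_differentiable_def)

lemma xjet_has_derivative:
  assumes "jet_defined a b t0 T u (Int_Deriv n 0)" "r < n" "x \<in> {a<..<b}" "t \<in> {t0<..<T}"
  shows "((\<lambda>y. xjet u y t r) has_real_derivative xjet u x t (Suc r)) (at x)"
  using assms
  by (simp add: xjet_def times_differentiable_def DERIV_deriv_iff_real_differentiable)

theorem theorem1:
  fixes p q m :: nat
    and \<alpha> a b t0 T :: real
    and kind :: frac_kind
    and K :: "(nat \<Rightarrow> real) \<Rightarrow> real"
    and W :: "(nat \<Rightarrow> real) set"
    and U :: "(real \<Rightarrow> real \<Rightarrow> real) set"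
    and \<rho> :: "real \<Rightarrow> real"
    and Gbar :: dfun
  assumes "p \<ge> 1" and "q \<ge> 1"
    and "real p - 1 < \<alpha>" and "\<alpha> < real p"
    and "a < b" and "t0 < T"
    and "open W" and "depends_only_on {..m} (\<lambda>z. z \<in> W)"
    and "depends_only_on {..m} K" and "C_k_on q W K"
    and "\<And>u. u \<in> U \<Longrightarrow> regular_for a b t0 T kind p \<alpha> q m W u"
    and "differential_function a b t0 T U (density_jets p \<alpha>) Gbar"
    and "\<And>u x t. u \<in> U \<Longrightarrow> x \<in> {a<..<b} \<Longrightarrow> t \<in> {t0<..<T} \<Longrightarrow>
           (\<lambda>s. on_jet t0 Gbar u x s) differentiable at t \<and>
           \<rho> t * frac_deriv kind p \<alpha> t0 u x t = deriv (\<lambda>s. on_jet t0 Gbar u x s) t"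
  shows "\<forall>k\<in>{0..q - 1}. conservation_law a b t0 T p \<alpha> U (pde kind p \<alpha> t0 q K)
           (\<lambda>u x t. x ^ k * \<rho> t * pde kind p \<alpha> t0 q K u x t)"
proof
  fix k assume k: "k \<in> {0..q - 1}"
  define DK where "DK = total_deriv_iter m K"
  \<comment> \<open>The entries \<open>Int_Deriv r 0\<close> are the pure
    \<open>x\<close>-derivatives that \<open>K\<close> sees. The index \<open>q - 1\<close> makes
    the derivative of \<open>P\<close> end in \<open>DK q\<close>.\<close>
  define P where "P = (\<lambda>x z. by_parts (\<lambda>i. DK i (\<lambda>r. z (Int_Deriv r 0))) k (q - 1) x)"
  \<comment> \<open>The factor \<open>\<rho> t\<close> is constant for \<open>D_x\<close>, so no
    regularity of \<open>\<rho>\<close> enters; likewise \<open>x ^ k\<close> in \<open>G\<close> is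
    constant for \<open>D_t\<close>.\<close>
  define F :: dfun where "F = (\<lambda>x t z. - \<rho> t * P x z)"
  define G :: dfun where "G = (\<lambda>x t z. x ^ k * Gbar x t z)"
  \<comment> \<open>\<open>DK i\<close> with \<open>i \<le> q - 1\<close> reads coordinates up to
    \<open>m + i\<close>, and \<open>regular_for\<close> makes all entries up to
    \<open>m + q\<close> meaningful.\<close>
  let ?S = "(\<lambda>r. Int_Deriv r 0) ` {..m + q}"
  have jetU: "jet_defined a b t0 T u (Int_Deriv (m + q) 0)" if "u \<in> U" for u
    using assms(11)[OF that] by (simp add: regular_for_def)
  have "depends_only_on ?S (P x)" for x
    unfolding depends_only_on_def P_def
  proof (intro allI impI by_parts_cong)
    fix z z' :: "jet \<Rightarrow> real" and i
    assume "\<forall>c\<in>?S. z c = z' c" "i \<le> q - 1"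
    then show "DK i (\<lambda>r. z (Int_Deriv r 0)) = DK i (\<lambda>r. z' (Int_Deriv r 0))"
      unfolding DK_def
      by (intro depends_only_onD[OF depends_only_on_total_deriv_iter[OF assms(9)]]) auto
  qed
  then have "differential_function a b t0 T U UNIV (\<lambda>x t. P x)"
    unfolding differential_function_def
    using jet_defined_Int_Deriv_mono[OF jetU] by (intro exI[of _ ?S]) blast
  then have dfF: "differential_function a b t0 T U UNIV F"
    unfolding F_def by (rule differential_function_scale)
  have dfG: "differential_function a b t0 T U (density_jets p \<alpha>) G"
    unfolding G_def by (rule differential_function_scale[OF assms(12)])
  have div: "(\<lambda>y. on_jet t0 F u y t) differentiable at x \<and>
      (\<lambda>s. on_jet t0 G u x s) differentiable at t \<and>
      x ^ k * \<rho> t * pde kind p \<alpha> t0 q K u x t =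
        deriv (\<lambda>y. on_jet t0 F u y t) x + deriv (\<lambda>s. on_jet t0 G u x s) t"
    if u: "u \<in> U" and x: "x \<in> {a<..<b}" and t: "t \<in> {t0<..<T}" for u x t
  proof -
    have inW: "xjet u y t \<in> W" if "y \<in> {a<..<b}" for y
      using assms(11)[OF u] that t by (simp add: regular_for_def)
    note dx = xjet_has_derivative[OF jetU[OF u] _ _ t]
    have onF: "on_jet t0 F u y t = - \<rho> t * by_parts (\<lambda>i. DK i (xjet u y t)) k (q - 1) y" for y
      by (simp add: on_jet_def F_def P_def xjet_def[abs_def])
    have "((\<lambda>y. DK i (xjet u y t)) has_real_derivative DK (Suc i) (xjet u x t)) (at x)"
      if "i \<le> q - 1" for i
      unfolding DK_def using that \<open>q \<ge> 1\<close>
      by (intro has_derivative_total_deriv_iter[OF assms(7,10,9)] inW[OF x] dx[OF _ x]) auto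
    then have "((\<lambda>y. by_parts (\<lambda>i. DK i (xjet u y t)) k (q - 1) y) has_real_derivative
        x ^ k * DK (Suc (q - 1)) (xjet u x t)) (at x)"
      using k by (intro has_derivative_by_parts[of k "q - 1" "\<lambda>i y. DK i (xjet u y t)"]) auto
    then have "((\<lambda>y. on_jet t0 F u y t) has_real_derivative
        - \<rho> t * (x ^ k * DK q (xjet u x t))) (at x)"
      unfolding onF using \<open>q \<ge> 1\<close> by (intro DERIV_cmult) simp
    \<comment> \<open>This ties the jet-space expression \<open>DK q\<close> to the actual
      \<open>q\<close>-th derivative in the PDE; the jet of \<open>u\<close> stays in
      \<open>W\<close> over the whole interval.\<close>
    moreover have "(deriv ^^ q) (\<lambda>y. K (xjet u y t)) x = DK q (xjet u x t)"
      unfolding DK_def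
      by (rule iterated_deriv_along_jet[OF assms(7,10,9), where X = "{a<..<b}"])
         (use x inW dx in auto)
    ultimately have F': "((\<lambda>y. on_jet t0 F u y t) has_real_derivative
        - \<rho> t * (x ^ k * (deriv ^^ q) (\<lambda>y. K (xjet u y t)) x)) (at x)"
      by simp
    have "((\<lambda>s. on_jet t0 Gbar u x s) has_real_derivative \<rho> t * frac_deriv kind p \<alpha> t0 u x t) (at t)"
      using assms(13)[OF u x t] by (simp add: DERIV_deriv_iff_real_differentiable)
    then have G': "((\<lambda>s. on_jet t0 G u x s) has_real_derivative
        x ^ k * (\<rho> t * frac_deriv kind p \<alpha> t0 u x t)) (at t)"
      using DERIV_cmult by (fastforce simp: on_jet_def G_def)
    show ?thesis
      using F' G' real_differentiable_def
      by (auto simp: DERIV_imp_deriv pde_def algebra_simps)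
  qed
  have "total_divergence a b t0 T p \<alpha> U (\<lambda>u x t. x ^ k * \<rho> t * pde kind p \<alpha> t0 q K u x t)"
    unfolding total_divergence_def using dfF dfG div by blast
  \<comment> \<open>Vanishing on solutions is immediate, as the expression has the PDE operator as a
    factor.\<close>
  then show "conservation_law a b t0 T p \<alpha> U (pde kind p \<alpha> t0 q K)
      (\<lambda>u x t. x ^ k * \<rho> t * pde kind p \<alpha> t0 q K u x t)"
    unfolding conservation_law_def by simp
qed

end
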